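(* Let $n\in\mathbb{N}$, $N=3$ and $H=\mathbb{R}^n$, $X=H^3$. Let $g:\mathbb{R}^n\to\,]-\infty,+\infty]$ and $h:\mathbb{R}^n\to\,]-\infty,+\infty]$ be proper, lower semicontinuous and convex functions. Suppose that $f=(g\oplus h)^c$, that is, $$f(x)=\sup_{y,z\in\mathbb{R}^n}\big(c(x,y,z)-g(y)-h(z)\big)\qquad\text{for all }x\in\mathbb{R}^n$$ (in particular, this holds if $(f,g,h)$ is a $c$-conjugate triple), and that $f$ is essentially smooth. Let $\Gamma$ be the $c$-splitting set generated by $(f,g,h)$. Write $(f_1,f_2,f_3)=(f,g,h)$. Then all of the following assertions hold: (i) there exists $1\le i_0\le 3$ such that $A_{i_0}$ is maximally monotone; (ii) there exists $1\le i_0\le 3$ such that $A_{i_0}=\partial f_{i_0}$; (iii) $A_i=\partial f_i$ for each $1\le i\le 3$; (iv) $\operatorname{Prox}_{f_1}+\operatorname{Prox}_{f_2}+\operatorname{Prox}_{f_3}=\mathrm{Id}$; (v) $e_{f_1^*}+e_{f_2^*}+e_{f_3^*}=q$; and $\Gamma$ is maximally $c$-monotone.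
   Context: $H=\mathbb{R}^n$ with the Euclidean inner product $\langle\cdot,\cdot\rangle$ and norm $\|\cdot\|$; $X=X_1\times X_2\times X_3$ with every $X_i=H$. The cost function is $c:X\to\mathbb{R}$, $c(x_1,x_2,x_3)=\langle x_1,x_2\rangle+\langle x_2,x_3\rangle+\langle x_1,x_3\rangle$. Write $q=\frac12\|\cdot\|^2$. Given functions $u_i:H\to\,]-\infty,+\infty]$, $i=1,2,3$, with $c(x)\le\sum_i u_i(x_i)$ for all $x=(x_1,x_2,x_3)\in X$, the $c$-splitting set generated by $(u_1,u_2,u_3)$ is the set of all $x\in X$ with $c(x)=\sum_i u_i(x_i)$. A triple of proper functions $(f_1,f_2,f_3)$ is a $c$-conjugate triple if for each $i_0$ and each $x_{i_0}\in H$, $f_{i_0}(x_{i_0})=\sup\{c(x_1,x_2,x_3)-\sum_{i\ne i_0}f_i(x_i)\mid x_i\in H,\ i\neq i_0\}$. A set $\Gamma\subseteq X$ is $c$-monotone if for all $(x_1^1,x_2^1,x_3^1),(x_1^2,x_2^2,x_3^2)\in\Gamma$ and all permutations $\sigma_1,\sigma_2,\sigma_3$ of $\{1,2\}$, $\sum_{j=1}^2 c(x_1^{\sigma_1(j)},x_2^{\sigma_2(j)},x_3^{\sigma_3(j)})\le\sum_{j=1}^2 c(x_1^j,x_2^j,x_3^j)$. It is maximally $c$-monotone if it is $c$-monotone and has no proper $c$-monotone extension in $X$. For $1\le i\le 3$, the set-valued mapping $A_i:H\rightrightarrows H$ is defined by $\operatorname{gra}A_i=\{(x_i,\sum_{k\ne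 i}x_k)\mid(x_1,x_2,x_3)\in\Gamma\}$. Maximally monotone is meant in the classical sense for set-valued operators on $H$. $\partial$ denotes the convex subdifferential; $f^*(u)=\sup_{x\in H}(\langle u,x\rangle-f(x))$ the Fenchel conjugate; $e_f(s)=\inf_{x\in H}(f(x)+q(s-x))$ the Moreau envelope; $\operatorname{Prox}_f(x)=\operatorname{argmin}_{y\in H}(f(y)+q(y-x))$ the proximity operator of a proper lower semicontinuous convex function. Essentially smooth is meant in the standard sense of convex analysis: a proper convex function $f$ on $\mathbb{R}^n$ is essentially smooth if the interior of $\operatorname{dom}f$ is nonempty, $f$ is differentiable on it, and $\|\nabla f(x_k)\|\to\infty$ whenever $(x_k)$ is a sequence in the interior of $\operatorname{dom}f$ converging to a boundary point of $\operatorname{dom}f$. *)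

theory Defs
  imports "HOL-Analysis.Analysis"
begin

text \<open>Functions into \<open>]-\<infinity>,+\<infinity>]\<close> are functions into \<^typ>\<open>ereal\<close>
  that never take the value \<open>-\<infinity>\<close>; this is part of \<open>proper\<close>.\<close>

definition edom :: "('a \<Rightarrow> ereal) \<Rightarrow> 'a set" where
  "edom f = {x. f x < \<infinity>}"

definition proper :: "('a \<Rightarrow> ereal) \<Rightarrow> bool" where
  "proper f \<longleftrightarrow> (\<forall>x. f x \<noteq> -\<infinity>) \<and> edom f \<noteq> {}"

text \<open>The punctured liminf of the library gives the same notion as the liminf over full
  neighbourhoods.\<close>

definition lsc :: "('a::topological_space \<Rightarrow> ereal) \<Rightarrow> bool" where
  "lsc f \<longleftrightarrow> (\<forall>x. f x \<le> Liminf (at x) f)"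

definition econvex :: "('a::real_vector \<Rightarrow> ereal) \<Rightarrow> bool" where
  "econvex f \<longleftrightarrow> convex {(x, r::real). f x \<le> ereal r}"

text \<open>Differentiability and the gradient refer to the real-valued function
  \<open>real_of_ereal \<circ> f\<close>, which agrees with \<open>f\<close> near every point of the interior of the domain of
  a proper \<open>f\<close>; \<open>GDERIV\<close> is the library's (unique) gradient.\<close>

definition essentially_smooth :: "('a::euclidean_space \<Rightarrow> ereal) \<Rightarrow> bool" where
  "essentially_smooth f \<longleftrightarrow>
     proper f \<and> econvex f \<and> interior (edom f) \<noteq> {} \<and>
     (\<forall>x\<in>interior (edom f). (\<lambda>y. real_of_ereal (f y)) differentiable (at x)) \<and>
     (\<forall>X D x. (\<forall>k::nat. X k \<in> interior (edom f) \<and> GDERIV (\<lambda>y. real_of_ereal (f y)) (X k) :> D k)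
        \<longrightarrow> X \<longlonglongrightarrow> x \<longrightarrow> x \<in> frontier (edom f)
        \<longrightarrow> filterlim (\<lambda>k. norm (D k)) at_top sequentially)"

definition q :: "'a::real_inner \<Rightarrow> real" where
  "q x = (norm x)\<^sup>2 / 2"

definition fenchel_conjugate :: "('a::real_inner \<Rightarrow> ereal) \<Rightarrow> 'a \<Rightarrow> ereal" where
  "fenchel_conjugate f u = (SUP x. ereal (u \<bullet> x) - f x)"

definition moreau_envelope :: "('a::real_inner \<Rightarrow> ereal) \<Rightarrow> 'a \<Rightarrow> ereal" where
  "moreau_envelope f s = (INF x. f x + ereal (q (s - x)))"

text \<open>For proper, lower semicontinuous and convex \<open>f\<close> the minimizer exists and is unique, so the
  choice made by \<^const>\<open>arg_min\<close> is immaterial.\<close>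

definition Prox :: "('a::real_inner \<Rightarrow> ereal) \<Rightarrow> 'a \<Rightarrow> 'a" where
  "Prox f x = (ARG_MIN (\<lambda>y. f y + ereal (q (y - x))) y. True)"

text \<open>Set-valued mappings are identified with their graphs.\<close>

definition subdifferential :: "('a::real_inner \<Rightarrow> ereal) \<Rightarrow> 'a rel" where
  "subdifferential f = {(x, u). x \<in> edom f \<and> (\<forall>y. f x + ereal (u \<bullet> (y - x)) \<le> f y)}"

definition monotone_operator :: "'a::real_inner rel \<Rightarrow> bool" where
  "monotone_operator A \<longleftrightarrow>
     (\<forall>(x, u)\<in>A. \<forall>(y, v)\<in>A. 0 \<le> (x - y) \<bullet> (u - v))"

definition maximally_monotone :: "'a::real_inner rel \<Rightarrow> bool" where
  "maximally_monotone A \<longleftrightarrow>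
     monotone_operator A \<and> (\<forall>B. monotone_operator B \<longrightarrow> A \<subseteq> B \<longrightarrow> B = A)"

text \<open>Points of \<open>X = H \<times> H \<times> H\<close> have type \<^typ>\<open>'a^3\<close>, and the indices \<open>1, 2, 3\<close> are the elements
  of the three-element type \<open>3\<close> (in which \<open>3 = 0\<close>).\<close>

definition cost :: "'a::real_inner^3 \<Rightarrow> real" where
  "cost x = x$1 \<bullet> x$2 + x$2 \<bullet> x$3 + x$1 \<bullet> x$3"

definition c_conjugate ::
    "('a::real_inner \<Rightarrow> ereal) \<Rightarrow> ('a \<Rightarrow> ereal) \<Rightarrow> 'a \<Rightarrow> ereal" where
  "c_conjugate g h x = (SUP (y, z). ereal (cost (vector [x, y, z])) - g y - h z)"

definition c_conjugate_triple :: "(3 \<Rightarrow> 'a::real_inner \<Rightarrow> ereal) \<Rightarrow> bool" where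
  "c_conjugate_triple F \<longleftrightarrow>
     (\<forall>i. proper (F i)) \<and>
     (\<forall>i\<^sub>0 t. F i\<^sub>0 t = (SUP x\<in>{x. x$i\<^sub>0 = t}. ereal (cost x) - (\<Sum>i\<in>UNIV - {i\<^sub>0}. F i (x$i))))"

definition c_splitting_set :: "(3 \<Rightarrow> 'a::real_inner \<Rightarrow> ereal) \<Rightarrow> ('a^3) set" where
  "c_splitting_set F = {x. ereal (cost x) = (\<Sum>i\<in>UNIV. F i (x$i))}"

definition c_monotone :: "('a::real_inner^3) set \<Rightarrow> bool" where
  "c_monotone \<Gamma> \<longleftrightarrow>
     (\<forall>(p :: nat \<Rightarrow> 'a^3) (\<sigma> :: 3 \<Rightarrow> nat \<Rightarrow> nat).
        (\<forall>j\<in>{1,2}. p j \<in> \<Gamma>) \<and> (\<forall>i. \<sigma> i permutes {1,2}) \<longrightarrow>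
        (\<Sum>j\<in>{1,2}. cost (\<chi> i. p (\<sigma> i j) $ i)) \<le> (\<Sum>j\<in>{1,2}. cost (p j)))"

definition maximally_c_monotone :: "('a::real_inner^3) set \<Rightarrow> bool" where
  "maximally_c_monotone \<Gamma> \<longleftrightarrow>
     c_monotone \<Gamma> \<and> (\<forall>\<Delta>. c_monotone \<Delta> \<longrightarrow> \<Gamma> \<subseteq> \<Delta> \<longrightarrow> \<Delta> = \<Gamma>)"

definition A_op :: "('a::real_inner^3) set \<Rightarrow> 3 \<Rightarrow> 'a rel" where
  "A_op \<Gamma> i = {(x$i, \<Sum>k\<in>UNIV - {i}. x$k) | x. x \<in> \<Gamma>}"

lemma c_conjugate_triple_imp_c_conjugate:
  fixes F :: "3 \<Rightarrow> 'a::real_inner \<Rightarrow> ereal"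
  assumes "c_conjugate_triple F"
  shows "F 1 = c_conjugate (F 2) (F 3)"
proof
  fix t
  have nm: "F i s \<noteq> -\<infinity>" for i s
    using assms unfolding c_conjugate_triple_def proper_def by blast
  have U: "(UNIV :: 3 set) - {1} = {2, 3}"
    unfolding UNIV_3 by simp
  have S: "{x::'a^3. x$1 = t} = range (\<lambda>(y, z). vector [t, y, z])" (is "?L = ?R")
  proof
    show "?L \<subseteq> ?R"
    proof
      fix x :: "'a^3" assume "x \<in> ?L"
      then have "x = vector [t, x$2, x$3]"
        by (simp add: vec_eq_iff forall_3)
      then have "x = (\<lambda>(y, z). vector [t, y, z]) (x$2, x$3)"
        unfolding prod.case .
      then show "x \<in> ?R" by (rule range_eqI)
    qed
    show "?R \<subseteq> ?L"
      by (rule image_subsetI) (simp only: case_prod_unfold mem_Collect_eq vector_3)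
  qed
  have sum23: "(\<Sum>i\<in>{2, 3}. F i (x$i)) = F 2 (x$2) + F 3 (x$3)" for x
    by simp
  have E: "ereal c - (a + b) = ereal c - a - b" if "a \<noteq> -\<infinity>" "b \<noteq> -\<infinity>" for c a b
    using that by (cases a; cases b) auto
  have "F 1 t = (SUP x\<in>{x. x$1 = t}. ereal (cost x) - (\<Sum>i\<in>UNIV - {1}. F i (x$i)))"
    using assms unfolding c_conjugate_triple_def by blast
  also have "\<dots> = (SUP x\<in>{x. x$1 = t}. ereal (cost x) - F 2 (x$2) - F 3 (x$3))"
    unfolding U by (simp only: sum23 E[OF nm nm])
  also have "\<dots> = c_conjugate (F 2) (F 3) t"
    unfolding S c_conjugate_def image_image case_prod_unfold by (simp only: vector_3)
  finally show "F 1 t = c_conjugate (F 2) (F 3) t" .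
qed

end

theory Submission
  imports Defs
begin

text \<open>Everything rests on one fact: the coordinate sums of the points of \<open>\<Gamma>\<close> fill the whole space.

  Suppose that \<open>x \<in> \<Gamma>\<close> has coordinate sum \<open>s\<close>. Since the cost is affine in each coordinate with slope
  the sum of the other two, the inequality \<open>c \<le> \<Sum>f\<^sub>i\<close>, with equality at \<open>x\<close>, says that \<open>s - x\<^sub>i\<close> is a subgradient
  of \<open>f\<^sub>i\<close> at \<open>x\<^sub>i\<close>, that is, \<open>x\<^sub>i\<close> is the proximal point of \<open>s\<close> for every \<open>i\<close>. If such an \<open>x\<close> exists for every
  \<open>s\<close>, the proximal points of \<open>s\<close> add up to \<open>s\<close>. The envelope of \<open>f\<^sub>i\<^sup>*\<close> at \<open>s\<close> is
  \<open>\<langle>x\<^sub>i, s\<rangle> - q x\<^sub>i - f\<^sub>i x\<^sub>i\<close>, and these three numbers add up to \<open>q s\<close> because the cost of \<open>x\<close> is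
  \<open>q s - \<Sum>q x\<^sub>i\<close>. The maximality assertions are Minty's argument: a point monotonically related to the point
  with the same sum is equal to it. All this is \<open>splitting_set_if_sums_fill\<close>.

  To produce a point of \<open>\<Gamma>\<close> with sum \<open>s\<close>, let \<open>p\<close> be the proximal point of \<open>s\<close> with respect to the
  convex function \<open>f\<close> (\<open>proximal_point_exists\<close>), so that \<open>s - p\<close> is a subgradient of \<open>f\<close> at \<open>p\<close>. Essential
  smoothness places \<open>p\<close> in the interior of the domain (\<open>subgradient_point_interior\<close>). At interior points the
  supremum that defines \<open>f p\<close> is attained, at some \<open>y\<close> and \<open>z\<close> (\<open>c_conjugate_attained\<close>). Then \<open>(p, y, z)\<close> is
  in \<open>\<Gamma>\<close>, so \<open>y + z\<close> is a subgradient of \<open>f\<close> at \<open>p\<close> too. As \<open>f\<close> is differentiable at \<open>p\<close>, subgradients there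
  are unique (\<open>subgradient_unique\<close>); therefore \<open>y + z = s - p\<close>, and the coordinate sum is \<open>s\<close>.\<close>

section \<open>Subgradients, proximal points and envelopes\<close>

lemma subdifferentialI:
  assumes "f p = ereal a" "\<And>y. f y \<noteq> -\<infinity>"
    and "\<And>y b. f y = ereal b \<Longrightarrow> a + u \<bullet> (y - p) \<le> b"
  shows "(p, u) \<in> subdifferential f"
proof -
  have "f p + ereal (u \<bullet> (y - p)) \<le> f y" for y
    using assms(1) assms(2)[of y] assms(3)[of y] by (cases "f y") auto
  then show ?thesis
    using assms(1) by (auto simp: subdifferential_def edom_def)
qed

lemma subdifferentialE:
  assumes "(p, u) \<in> subdifferential f" "\<And>y. f y \<noteq> -\<infinity>"
  obtains a where "f p = ereal a" "\<And>y. ereal (a + u \<bullet> (y - p)) \<le> f y"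
proof -
  obtain a where "f p = ereal a"
    using assms unfolding subdifferential_def edom_def by (cases "f p") auto
  then show ?thesis
    using assms(1) that unfolding subdifferential_def by auto
qed

lemma monotone_subdifferential:
  assumes "\<And>y. f y \<noteq> -\<infinity>"
  shows "monotone_operator (subdifferential f)"
  unfolding monotone_operator_def
proof (clarify)
  fix x u y v
  assume "(x, u) \<in> subdifferential f" and "(y, v) \<in> subdifferential f"
  then obtain a b where "f x = ereal a" "\<And>z. ereal (a + u \<bullet> (z - x)) \<le> f z"
    and "f y = ereal b" "\<And>z. ereal (b + v \<bullet> (z - y)) \<le> f z"
    using assms by (metis subdifferentialE)
  then have "a + u \<bullet> (y - x) \<le> b" "b + v \<bullet> (x - y) \<le> a"
    by (metis ereal_less_eq(3))+
  then show "0 \<le> (x - y) \<bullet> (u - v)"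
    by (simp add: inner_diff inner_commute)
qed

text \<open>If a pair \<open>(y, v)\<close> is monotonically related to the graph, compare it with the point
  of the graph that has the same sum \<open>y + v\<close>; the two must coincide.\<close>

lemma maximally_monotone_if_surjective_sum:
  assumes mono: "monotone_operator A" and surj: "\<And>x. \<exists>p. (p, x - p) \<in> A"
  shows "maximally_monotone A"
  unfolding maximally_monotone_def
proof (intro conjI allI impI mono)
  fix B assume B: "monotone_operator B" "A \<subseteq> B"
  have "(y, v) \<in> A" if "(y, v) \<in> B" for y v
  proof -
    obtain p where p: "(p, (y + v) - p) \<in> A" using surj by blast
    then have "0 \<le> (y - p) \<bullet> (v - ((y + v) - p))"
      using B that unfolding monotone_operator_def by blast
    then have "(y - p) \<bullet> (y - p) \<le> 0" by (simp add: inner_diff)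
    then have "y = p" by (metis inner_gt_zero_iff not_less right_minus_eq)
    then show ?thesis using p by simp
  qed
  then show "B = A" using B(2) by auto
qed

lemma Prox_eqI:
  assumes p: "(p, x - p) \<in> subdifferential f" and nm: "\<And>y. f y \<noteq> -\<infinity>"
  shows "Prox f x = p"
proof -
  obtain a where a: "f p = ereal a" "\<And>y. ereal (a + (x - p) \<bullet> (y - p)) \<le> f y"
    using subdifferentialE[OF p nm] by blast
  \<comment> \<open>The quadratic term turns the subgradient inequality into quadratic growth about \<open>p\<close>.\<close>
  have growth: "f p + ereal (q (p - x)) + ereal (q (y - p)) \<le> f y + ereal (q (y - x))" for y
  proof -
    have "a + q (p - x) + q (y - p) = a + (x - p) \<bullet> (y - p) + q (y - x)"
      by (simp add: q_def power2_norm_eq_inner inner_diff inner_commute field_simps)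
    then have "f p + ereal (q (p - x)) + ereal (q (y - p))
        = ereal (a + (x - p) \<bullet> (y - p)) + ereal (q (y - x))"
      by (simp only: a(1) plus_ereal.simps)
    also have "\<dots> \<le> f y + ereal (q (y - x))" by (rule add_right_mono[OF a(2)])
    finally show ?thesis .
  qed
  have "is_arg_min (\<lambda>y. f y + ereal (q (y - x))) (\<lambda>_. True) y \<longleftrightarrow> y = p" for y
  proof
    assume "is_arg_min (\<lambda>y. f y + ereal (q (y - x))) (\<lambda>_. True) y"
    then have "f y + ereal (q (y - x)) \<le> f p + ereal (q (p - x))"
      by (simp add: is_arg_min_def not_less)
    with growth[of y] have "f p + ereal (q (p - x)) + ereal (q (y - p)) \<le> f p + ereal (q (p - x))"
      by (rule order_trans)
    then have "q (y - p) \<le> 0" using a(1) by simp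
    then show "y = p" by (simp add: q_def)
  next
    assume "y = p"
    moreover have "f p + ereal (q (p - x)) \<le> f z + ereal (q (z - x))" for z
      using order_trans[OF _ growth[of z]] a(1) by (simp add: q_def)
    ultimately show "is_arg_min (\<lambda>y. f y + ereal (q (y - x))) (\<lambda>_. True) y"
      by (simp add: is_arg_min_def not_less)
  qed
  then have "is_arg_min (\<lambda>y. f y + ereal (q (y - x))) (\<lambda>_. True) = (\<lambda>y. y = p)" by blast
  then show ?thesis unfolding Prox_def arg_min_def by simp
qed

text \<open>The point \<open>x - p\<close> minimizes the function defining the envelope, because
  \<open>f\<^sup>*\<close> lies above its affine minorant with slope \<open>p\<close>, which is exact there.\<close>

lemma moreau_envelope_conjugate_eq:
  assumes p: "(p, x - p) \<in> subdifferential f" and nm: "\<And>y. f y \<noteq> -\<infinity>" and a: "f p = ereal a"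
  shows "moreau_envelope (fenchel_conjugate f) x = ereal (p \<bullet> x - q p - a)"
proof (rule antisym)
  have sub: "ereal (a + (x - p) \<bullet> (y - p)) \<le> f y" for y
    using subdifferentialE[OF p nm] a by (metis ereal.inject)
  have "fenchel_conjugate f (x - p) \<le> ereal ((x - p) \<bullet> p - a)"
    unfolding fenchel_conjugate_def
  proof (rule SUP_least)
    fix y
    show "ereal ((x - p) \<bullet> y) - f y \<le> ereal ((x - p) \<bullet> p - a)"
      using sub[of y] nm[of y] by (cases "f y") (auto simp: inner_diff_right)
  qed
  then have "fenchel_conjugate f (x - p) + ereal (q p) \<le> ereal ((x - p) \<bullet> p - a) + ereal (q p)"
    by (rule add_right_mono)
  also have "\<dots> = ereal (p \<bullet> x - q p - a)"
    by (simp add: q_def power2_norm_eq_inner inner_diff inner_commute)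
  finally have up: "fenchel_conjugate f (x - p) + ereal (q (x - (x - p))) \<le> ereal (p \<bullet> x - q p - a)"
    by simp
  show "moreau_envelope (fenchel_conjugate f) x \<le> ereal (p \<bullet> x - q p - a)"
    unfolding moreau_envelope_def using up by (intro INF_lower2[where i = "x - p"]) auto
next
  show "ereal (p \<bullet> x - q p - a) \<le> moreau_envelope (fenchel_conjugate f) x"
    unfolding moreau_envelope_def
  proof (rule INF_greatest)
    fix s
    have "ereal (s \<bullet> p) - f p \<le> fenchel_conjugate f s"
      unfolding fenchel_conjugate_def by (rule SUP_upper) simp
    then have "ereal (s \<bullet> p - a) + ereal (q (x - s)) \<le> fenchel_conjugate f s + ereal (q (x - s))"
      using a by (intro add_right_mono) simp
    moreover have "s \<bullet> p - a + q (x - s) = p \<bullet> x - q p - a + q (x - p - s)"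
      by (simp add: q_def power2_norm_eq_inner inner_diff inner_commute) (simp add: field_simps)
    moreover have "0 \<le> q (x - p - s)" by (simp add: q_def)
    ultimately have "ereal (p \<bullet> x - q p - a) \<le> ereal (s \<bullet> p - a) + ereal (q (x - s))"
      by simp
    also note \<open>\<dots> \<le> fenchel_conjugate f s + ereal (q (x - s))\<close>
    finally show "ereal (p \<bullet> x - q p - a) \<le> fenchel_conjugate f s + ereal (q (x - s))" .
  qed
qed

section \<open>Splitting sets whose coordinate sums fill the space\<close>

text \<open>The cost is affine in each coordinate separately, with slope the sum of the other two.\<close>

lemma cost_update:
  fixes x :: "'a::real_inner^3"
  shows "cost (\<chi> k. if k = i then y else x$k) = cost x + (y - x$i) \<bullet> (\<Sum>k\<in>UNIV - {i}. x$k)"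
proof -
  have U: "(\<Sum>k\<in>UNIV - {i}. x$k) = x$1 + x$2 + x$3 - x$i"
    by (simp add: sum_diff1 sum_3)
  have "\<forall>i. cost (\<chi> k. if k = i then y else x$k) = cost x + (y - x$i) \<bullet> (x$1 + x$2 + x$3 - x$i)"
    unfolding forall_3
    by (simp add: cost_def inner_diff inner_add inner_commute algebra_simps)
  then show ?thesis unfolding U by blast
qed

text \<open>This identity turns the splitting equality \<open>c x = \<Sum>f\<^sub>i x\<^sub>i\<close> into the sum formula for the
  envelopes.\<close>

lemma cost_eq_q: "cost x = q (\<Sum>i\<in>UNIV. x$i) - (\<Sum>i\<in>UNIV. q (x$i))"
  by (simp add: cost_def q_def sum_3 power2_norm_eq_inner inner_add inner_commute field_simps)

lemma sum_others:
  fixes x :: "'a::real_inner^3"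
  shows "(\<Sum>k\<in>UNIV - {i}. x$k) = (\<Sum>k\<in>UNIV. x$k) - x$i"
  by (simp add: sum_diff1)

definition dominates_cost :: "(3 \<Rightarrow> 'a::real_inner \<Rightarrow> ereal) \<Rightarrow> bool" where
  "dominates_cost F \<longleftrightarrow>
     (\<forall>i t. F i t \<noteq> -\<infinity>) \<and> (\<forall>x. ereal (cost x) \<le> (\<Sum>i\<in>UNIV. F i (x$i)))"

lemma c_splitting_setE:
  assumes "\<And>i t. F i t \<noteq> -\<infinity>" "x \<in> c_splitting_set F"
  obtains r where "\<And>i. F i (x$i) = ereal (r i)" "cost x = (\<Sum>i\<in>UNIV. r i)"
proof -
  have fin: "(\<Sum>i\<in>UNIV. F i (x$i)) = ereal (cost x)"
    using assms(2) unfolding c_splitting_set_def by simp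
  have "\<exists>a. F i (x$i) = ereal a" for i
  proof -
    have "F i (x$i) \<noteq> \<infinity>"
    proof
      assume "F i (x$i) = \<infinity>"
      then have "(\<Sum>i\<in>UNIV. F i (x$i)) = \<infinity>" unfolding sum_Pinfty by auto
      then show False using fin by simp
    qed
    then show ?thesis using assms(1)[of i "x$i"] by (cases "F i (x$i)") auto
  qed
  then obtain r where r: "\<And>i. F i (x$i) = ereal (r i)" by metis
  then have "cost x = (\<Sum>i\<in>UNIV. r i)" using fin by simp
  then show thesis using r that by blast
qed

text \<open>Vary the coordinate \<open>i\<close> alone: both sides of \<open>c \<le> \<Sum>f\<^sub>k\<close> agree at \<open>x\<close>, and the left-hand side is
  affine with the stated slope.\<close>

lemma splitting_point_subgradient:
  assumes F: "dominates_cost F" and x: "x \<in> c_splitting_set F"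
  shows "(x$i, \<Sum>k\<in>UNIV - {i}. x$k) \<in> subdifferential (F i)"
proof -
  have nm: "F i t \<noteq> -\<infinity>" for i t using F by (simp add: dominates_cost_def)
  obtain r where r: "\<And>i. F i (x$i) = ereal (r i)" "cost x = (\<Sum>i\<in>UNIV. r i)"
    using c_splitting_setE[OF nm x] by metis
  show ?thesis
  proof (rule subdifferentialI[where f = "F i" and p = "x$i", OF r(1) nm])
    fix y b assume b: "F i y = ereal b"
    let ?x = "\<chi> k. if k = i then y else x$k"
    have "F k (?x$k) = ereal ((r(i := b)) k)" for k using b r(1) by simp
    then have "(\<Sum>k\<in>UNIV. F k (?x$k)) = ereal (\<Sum>k\<in>UNIV. (r(i := b)) k)" by simp
    moreover have "ereal (cost ?x) \<le> (\<Sum>k\<in>UNIV. F k (?x$k))"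
      using F unfolding dominates_cost_def by blast
    moreover have "(\<Sum>k\<in>UNIV. (r(i := b)) k) = (\<Sum>k\<in>UNIV. r k) - r i + b"
      by (subst (1 2) sum.remove[of _ i]) auto
    ultimately show "r i + (\<Sum>k\<in>UNIV - {i}. x$k) \<bullet> (y - x$i) \<le> b"
      using r(2) by (simp add: cost_update inner_commute)
  qed
qed

text \<open>Permuting coordinates does not change the total of the values \<open>f\<^sub>i x\<^sub>i\<close>, which is the total cost of the
  original points and an upper bound for that of the permuted ones.\<close>

lemma c_monotone_c_splitting_set:
  fixes F :: "3 \<Rightarrow> 'a::real_inner \<Rightarrow> ereal"
  assumes F: "dominates_cost F"
  shows "c_monotone (c_splitting_set F)"
  unfolding c_monotone_def
proof (intro allI impI, elim conjE)
  fix p :: "nat \<Rightarrow> 'a^3" and \<sigma> :: "3 \<Rightarrow> nat \<Rightarrow> nat"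
  assume p: "\<forall>j\<in>{1, 2}. p j \<in> c_splitting_set F" and \<sigma>: "\<forall>i. \<sigma> i permutes {1, 2}"
  have nm: "F i t \<noteq> -\<infinity>" for i t using F by (simp add: dominates_cost_def)
  have "\<exists>r. (\<forall>i. F i (p j$i) = ereal (r i)) \<and> cost (p j) = (\<Sum>i\<in>UNIV. r i)" if "j \<in> {1, 2}" for j
  proof -
    have "p j \<in> c_splitting_set F" using p that by blast
    then show ?thesis using c_splitting_setE[of F "p j"] nm by metis
  qed
  then obtain r where r: "\<And>j i. j \<in> {1, 2} \<Longrightarrow> F i (p j$i) = ereal (r j i)"
    "\<And>j. j \<in> {1, 2} \<Longrightarrow> cost (p j) = (\<Sum>i\<in>UNIV. r j i)" by metis
  have "cost (\<chi> i. p (\<sigma> i j)$i) \<le> (\<Sum>i\<in>UNIV. r (\<sigma> i j) i)" if "j \<in> {1, 2}" for j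
  proof -
    have "\<sigma> i j \<in> {1, 2}" for i using \<sigma> that by (metis permutes_in_image)
    then have "(\<Sum>i\<in>UNIV. F i ((\<chi> i. p (\<sigma> i j)$i)$i)) = ereal (\<Sum>i\<in>UNIV. r (\<sigma> i j) i)"
      using r(1) by simp
    moreover have "ereal (cost (\<chi> i. p (\<sigma> i j)$i)) \<le> (\<Sum>i\<in>UNIV. F i ((\<chi> i. p (\<sigma> i j)$i)$i))"
      using F unfolding dominates_cost_def by blast
    ultimately show ?thesis by simp
  qed
  then have "(\<Sum>j\<in>{1, 2}. cost (\<chi> i. p (\<sigma> i j)$i)) \<le> (\<Sum>j\<in>{1, 2}. \<Sum>i\<in>UNIV. r (\<sigma> i j) i)"
    by (rule sum_mono)
  also have "\<dots> = (\<Sum>i\<in>UNIV. \<Sum>j\<in>{1, 2}. r (\<sigma> i j) i)" by (rule sum.swap)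
  also have "\<dots> = (\<Sum>i\<in>UNIV. \<Sum>j\<in>{1, 2}. r j i)"
  proof (rule sum.cong[OF refl])
    fix i
    have "\<sigma> i permutes {1, 2}" using \<sigma> by blast
    from sum.permute[OF this, of "\<lambda>j. r j i"]
    show "(\<Sum>j\<in>{1, 2}. r (\<sigma> i j) i) = (\<Sum>j\<in>{1, 2}. r j i)" by (simp only: comp_def)
  qed
  also have "\<dots> = (\<Sum>j\<in>{1, 2}. \<Sum>i\<in>UNIV. r j i)" by (rule sum.swap)
  also have "\<dots> = (\<Sum>j\<in>{1, 2}. cost (p j))" using r(2) by (intro sum.cong) auto
  finally show "(\<Sum>j\<in>{1, 2}. cost (\<chi> i. p (\<sigma> i j)$i)) \<le> (\<Sum>j\<in>{1, 2}. cost (p j))" .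
qed

text \<open>Exchanging the single coordinate \<open>i\<close> between two points changes the total cost by this
  inner product.\<close>

lemma c_monotone_imp_coordinate_monotone:
  assumes D: "c_monotone \<Delta>" and x: "x \<in> \<Delta>" and y: "y \<in> \<Delta>"
  shows "0 \<le> (x$i - y$i) \<bullet> ((\<Sum>k\<in>UNIV - {i}. x$k) - (\<Sum>k\<in>UNIV - {i}. y$k))"
proof -
  define p where "p j = (if j = (1::nat) then x else y)" for j
  define \<sigma> where "\<sigma> k = (if k = i then Transposition.transpose 1 (2::nat) else id)" for k :: 3
  have "\<sigma> k permutes {1, 2}" for k
    by (simp add: \<sigma>_def permutes_id permutes_swap_id)
  moreover have "\<forall>j\<in>{1, 2}. p j \<in> \<Delta>" using x y by (simp add: p_def)
  ultimately have "(\<Sum>j\<in>{1, 2}. cost (\<chi> k. p (\<sigma> k j)$k)) \<le> (\<Sum>j\<in>{1, 2}. cost (p j))"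
    using D unfolding c_monotone_def by blast
  moreover have "(\<chi> k. p (\<sigma> k 1)$k) = (\<chi> k. if k = i then y$i else x$k)"
    "(\<chi> k. p (\<sigma> k 2)$k) = (\<chi> k. if k = i then x$i else y$k)"
    by (auto simp: vec_eq_iff p_def \<sigma>_def)
  ultimately have "cost (\<chi> k. if k = i then y$i else x$k) + cost (\<chi> k. if k = i then x$i else y$k)
      \<le> cost x + cost y"
    by (simp add: p_def)
  then show ?thesis by (simp add: cost_update inner_diff)
qed

text \<open>A Minty-type principle. A point that is in \<open>c\<close>-monotone relation to a point with the same
  coordinate sum must coincide with it.\<close>

lemma maximally_c_monotone_if_sums_fill:
  fixes \<Gamma> :: "('a::real_inner^3) set"
  assumes mono: "c_monotone \<Gamma>" and fill: "\<And>s. \<exists>p\<in>\<Gamma>. (\<Sum>i\<in>UNIV. p$i) = s"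
  shows "maximally_c_monotone \<Gamma>"
  unfolding maximally_c_monotone_def
proof (intro conjI allI impI mono)
  fix \<Delta> :: "('a^3) set" assume D: "c_monotone \<Delta>" "\<Gamma> \<subseteq> \<Delta>"
  have "x \<in> \<Gamma>" if x: "x \<in> \<Delta>" for x
  proof -
    obtain p where p: "p \<in> \<Gamma>" "(\<Sum>i\<in>UNIV. p$i) = (\<Sum>i\<in>UNIV. x$i)" using fill by blast
    have "x$i = p$i" for i
    proof -
      have "0 \<le> (x$i - p$i) \<bullet> ((\<Sum>k\<in>UNIV - {i}. x$k) - (\<Sum>k\<in>UNIV - {i}. p$k))"
        using c_monotone_imp_coordinate_monotone[OF D(1) x] p(1) D(2) by blast
      then have "(x$i - p$i) \<bullet> (x$i - p$i) \<le> 0"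
        unfolding sum_others p(2) by (simp add: inner_diff)
      then show ?thesis by (metis inner_gt_zero_iff not_less right_minus_eq)
    qed
    then have "x = p" by (simp add: vec_eq_iff)
    then show ?thesis using p(1) by simp
  qed
  then show "\<Delta> = \<Gamma>" using D(2) by blast
qed

text \<open>A point \<open>p\<close> of the splitting set with sum \<open>s\<close> exhibits simultaneously the proximal points of \<open>s\<close>
  with respect to all three functions. This also gives the inclusion of each subdifferential in \<open>A\<^sub>i\<close>, by uniqueness of
  proximal points.\<close>

theorem splitting_set_if_sums_fill:
  fixes F :: "3 \<Rightarrow> 'a::real_inner \<Rightarrow> ereal"
  assumes F: "dominates_cost F"
    and fill: "\<And>s. \<exists>p\<in>c_splitting_set F. (\<Sum>i\<in>UNIV. p$i) = s"
  shows "maximally_monotone (A_op (c_splitting_set F) i)"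
    and "A_op (c_splitting_set F) i = subdifferential (F i)"
    and "Prox (F 1) x + Prox (F 2) x + Prox (F 3) x = x"
    and "moreau_envelope (fenchel_conjugate (F 1)) x
          + moreau_envelope (fenchel_conjugate (F 2)) x
          + moreau_envelope (fenchel_conjugate (F 3)) x = ereal (q x)"
    and "maximally_c_monotone (c_splitting_set F)"
proof -
  have nm: "F i t \<noteq> -\<infinity>" for i t using F by (simp add: dominates_cost_def)
  have sub: "(p$i, s - p$i) \<in> subdifferential (F i)"
    if "p \<in> c_splitting_set F" "(\<Sum>i\<in>UNIV. p$i) = s" for p s i
    using splitting_point_subgradient[OF F that(1), of i] unfolding sum_others that(2) .
  show A: "A_op (c_splitting_set F) i = subdifferential (F i)" for i
  proof (intro equalityI subrelI)
    fix y u assume "(y, u) \<in> A_op (c_splitting_set F) i"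
    then show "(y, u) \<in> subdifferential (F i)"
      unfolding A_op_def using splitting_point_subgradient[OF F] by blast
  next
    fix y u assume yu: "(y, u) \<in> subdifferential (F i)"
    obtain p where p: "p \<in> c_splitting_set F" "(\<Sum>i\<in>UNIV. p$i) = y + u" using fill by blast
    \<comment> \<open>Both \<open>y\<close> and \<open>p$i\<close> are the proximal point of \<open>y + u\<close>.\<close>
    have "y = p$i"
      using Prox_eqI[OF sub[OF p] nm] Prox_eqI[of y "y + u" "F i"] nm yu by simp
    then have "(y, u) = (p$i, \<Sum>k\<in>UNIV - {i}. p$k)" unfolding sum_others p(2) by simp
    then show "(y, u) \<in> A_op (c_splitting_set F) i" unfolding A_op_def using p(1) by blast
  qed
  show "maximally_monotone (A_op (c_splitting_set F) i)"
    unfolding A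
  proof (rule maximally_monotone_if_surjective_sum[OF monotone_subdifferential[OF nm]])
    fix s show "\<exists>p. (p, s - p) \<in> subdifferential (F i)" using fill[of s] sub by metis
  qed
  show "maximally_c_monotone (c_splitting_set F)"
    by (rule maximally_c_monotone_if_sums_fill[OF c_monotone_c_splitting_set[OF F] fill])
  obtain p where p: "p \<in> c_splitting_set F" "(\<Sum>i\<in>UNIV. p$i) = x" using fill by blast
  have "Prox (F i) x = p$i" for i by (rule Prox_eqI[OF sub[OF p] nm])
  then show "Prox (F 1) x + Prox (F 2) x + Prox (F 3) x = x"
    using p(2) by (simp add: sum_3)
  obtain r where r: "\<And>i. F i (p$i) = ereal (r i)" "cost p = (\<Sum>i\<in>UNIV. r i)"
    using c_splitting_setE[OF nm p(1)] by metis
  have "moreau_envelope (fenchel_conjugate (F i)) x = ereal (p$i \<bullet> x - q (p$i) - r i)" for i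
    by (rule moreau_envelope_conjugate_eq[OF sub[OF p] nm r(1)])
  moreover have "(\<Sum>i\<in>UNIV. p$i \<bullet> x - q (p$i) - r i) = q x"
  proof -
    have "(\<Sum>i\<in>UNIV. p$i \<bullet> x - q (p$i) - r i)
        = (\<Sum>i\<in>UNIV. p$i) \<bullet> x - (\<Sum>i\<in>UNIV. q (p$i)) - cost p"
      by (simp add: sum_subtractf inner_sum_left r(2))
    also have "\<dots> = x \<bullet> x - q x" unfolding cost_eq_q p(2) by simp
    also have "\<dots> = q x" by (simp add: q_def power2_norm_eq_inner)
    finally show ?thesis .
  qed
  ultimately show "moreau_envelope (fenchel_conjugate (F 1)) x
          + moreau_envelope (fenchel_conjugate (F 2)) x
          + moreau_envelope (fenchel_conjugate (F 3)) x = ereal (q x)"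
    by (simp add: sum_3)
qed

section \<open>Lower semicontinuity and existence of minimizers\<close>

text \<open>Lower semicontinuity as openness of the sets \<open>{f > r}\<close>, in the form that passes to sums,
  suprema and compositions with continuous maps by set operations.\<close>

definition open_superlevels :: "('a::topological_space \<Rightarrow> ereal) \<Rightarrow> bool" where
  "open_superlevels f \<longleftrightarrow> (\<forall>r::real. open {x. ereal r < f x})"

lemma lsc_imp_open_superlevels:
  assumes "lsc f"
  shows "open_superlevels f"
  unfolding open_superlevels_def
proof (intro allI, subst open_subopen, intro ballI)
  fix r x assume "x \<in> {x. ereal r < f x}"
  then have x: "ereal r < f x" by simp
  also have "f x \<le> Liminf (at x) f" using assms by (simp add: lsc_def)
  finally have "eventually (\<lambda>y. ereal r < f y) (at x)" by (rule less_LiminfD)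
  then obtain T where "open T" "x \<in> T" "\<forall>y\<in>T. y \<noteq> x \<longrightarrow> ereal r < f y"
    unfolding eventually_at_topological by auto
  then show "\<exists>T. open T \<and> x \<in> T \<and> T \<subseteq> {x. ereal r < f x}"
    using x by (intro exI[of _ T]) auto
qed

lemma open_superlevels_add:
  assumes f: "open_superlevels f" "\<And>x. f x \<noteq> -\<infinity>" and g: "open_superlevels g" "\<And>x. g x \<noteq> -\<infinity>"
  shows "open_superlevels (\<lambda>x. f x + g x)"
  unfolding open_superlevels_def
proof
  fix r :: real
  have "ereal r < f x + g x \<longleftrightarrow> (\<exists>a. ereal a < f x \<and> ereal (r - a) < g x)" for x
  proof
    assume "ereal r < f x + g x"
    then have "ereal r - g x < f x"
      using f(2)[of x] g(2)[of x] by (cases "f x"; cases "g x") auto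
    then obtain a where "ereal r - g x < ereal a" "ereal a < f x"
      using ereal_dense2 by blast
    then show "\<exists>a. ereal a < f x \<and> ereal (r - a) < g x"
      using g(2)[of x] by (intro exI[of _ a]) (cases "g x", auto)
  next
    assume "\<exists>a. ereal a < f x \<and> ereal (r - a) < g x"
    then show "ereal r < f x + g x" by (cases "f x"; cases "g x") auto
  qed
  then have "{x. ereal r < f x + g x} = (\<Union>a. {x. ereal a < f x} \<inter> {x. ereal (r - a) < g x})"
    by auto
  then show "open {x. ereal r < f x + g x}"
    using f(1) g(1) unfolding open_superlevels_def by (auto intro!: open_UN open_Int)
qed

lemma open_superlevels_continuous:
  assumes "continuous_on UNIV \<phi>"
  shows "open_superlevels (\<lambda>x. ereal (\<phi> x))"
  unfolding open_superlevels_def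
  using assms by (auto intro!: open_Collect_less continuous_intros)

lemma open_superlevels_comp:
  assumes "open_superlevels f" "continuous_on UNIV \<phi>"
  shows "open_superlevels (\<lambda>x. f (\<phi> x))"
  unfolding open_superlevels_def
proof
  fix r :: real
  have "{x. ereal r < f (\<phi> x)} = \<phi> -` {x. ereal r < f x}" by auto
  then show "open {x. ereal r < f (\<phi> x)}"
    using assms open_vimage unfolding open_superlevels_def by metis
qed

lemma attains_minimum:
  fixes f :: "'a::heine_borel \<Rightarrow> ereal"
  assumes f: "open_superlevels f" and nm: "\<And>x. f x \<noteq> -\<infinity>"
    and R: "f x0 = ereal R" and bdd: "bounded {x. f x \<le> ereal R}"
  obtains p where "\<And>x. f p \<le> f x"
proof -
  let ?K = "{x. f x \<le> ereal R}"
  have "closed ?K"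
    using f unfolding open_superlevels_def closed_def
    by (metis (no_types, lifting) Collect_cong Collect_neg_eq not_le)
  then have K: "compact ?K" using bdd by (simp add: compact_eq_bounded_closed)
  have "\<exists>p\<in>?K. \<forall>x\<in>?K. f p \<le> f x"
  proof (rule ccontr)
    assume no: "\<not> ?thesis"
    \<comment> \<open>Otherwise the sets where \<open>f\<close> exceeds one of its values on the sublevel set cover it; the
      least value used by a finite subcover is not covered.\<close>
    let ?U = "\<lambda>y. {x. f y < f x}"
    have "open (?U y)" if "y \<in> ?K" for y
    proof -
      have "\<exists>a. f y = ereal a" using that nm[of y] by (cases "f y") auto
      then show ?thesis using f unfolding open_superlevels_def by auto
    qed
    moreover have "?K \<subseteq> (\<Union>y\<in>?K. ?U y)" using no by (force simp: not_le)
    ultimately obtain C where C: "C \<subseteq> ?K" "finite C" "?K \<subseteq> (\<Union>y\<in>C. ?U y)"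
      using compactE_image[OF K] by metis
    have "x0 \<in> ?K" using R by simp
    then have "C \<noteq> {}" using C(3) by blast
    then have "Min (f ` C) \<in> f ` C" using C(2) by (intro Min_in) auto
    then obtain c where c: "c \<in> C" "f c = Min (f ` C)" by auto
    then obtain y where y: "y \<in> C" "f y < f c" using C(1,3) by blast
    have "f c \<le> f y" using C(2) y(1) c(2) by simp
    then show False using y(2) by simp
  qed
  then obtain p where p: "p \<in> ?K" "\<forall>x\<in>?K. f p \<le> f x" by blast
  have "f p \<le> f x" for x
    using p by (cases "x \<in> ?K") (auto intro: order_trans)
  then show thesis by (rule that)
qed

lemma le_of_square_le_affine:
  fixes t :: real
  assumes "t\<^sup>2 \<le> K * t + C" "0 \<le> K" "0 \<le> C"
  shows "t \<le> K + C + 1"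
proof (rule ccontr)
  assume "\<not> t \<le> K + C + 1"
  then have t: "K + C + 1 < t" "1 \<le> t" using assms by auto
  then have "(K + C + 1) * t < t * t" by (intro mult_strict_right_mono) auto
  moreover have "C * 1 \<le> C * t" using t assms by (intro mult_left_mono) auto
  ultimately show False using assms(1) t(2) by (simp add: power2_eq_square algebra_simps)
qed

section \<open>Existence of proximal points\<close>

lemma econvexD:
  assumes "econvex f" "f p \<le> ereal a" "f y \<le> ereal b" "0 \<le> t" "t \<le> 1"
  shows "f (p + t *\<^sub>R (y - p)) \<le> ereal (a + t * (b - a))"
proof -
  have "(1 - t) *\<^sub>R (p, a) + t *\<^sub>R (y, b) \<in> {(x, r::real). f x \<le> ereal r}"
    using assms unfolding econvex_def by (intro convexD) auto
  then show ?thesis by (simp add: algebra_simps)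
qed

text \<open>The quadratic term outgrows the affine minorant, so the function to be minimized has bounded
  sublevel sets; the first-order condition at a minimizer is the subgradient inequality.\<close>

lemma proximal_point_exists:
  fixes f :: "'a::euclidean_space \<Rightarrow> ereal"
  assumes f: "open_superlevels f" "econvex f" "\<And>y. f y \<noteq> -\<infinity>" "f x0 = ereal R"
    and minorant: "\<And>y. ereal (v \<bullet> y - \<beta>) \<le> f y"
  obtains p where "(p, x - p) \<in> subdifferential f"
proof -
  define G where "G y = f y + ereal (q (y - x))" for y
  have G: "open_superlevels G"
    unfolding G_def q_def
    by (intro open_superlevels_add f open_superlevels_continuous continuous_intros) auto
  have G0: "G x0 = ereal (R + q (x0 - x))" by (simp add: G_def f(4))
  have bdd: "bounded {y. G y \<le> ereal (R + q (x0 - x))}"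
  proof -
    define C where "C = 2 * \<bar>R + q (x0 - x) + \<beta> - v \<bullet> x\<bar>"
    have "norm (y - x) \<le> 2 * norm v + C + 1" if y: "G y \<le> ereal (R + q (x0 - x))" for y
    proof -
      have "ereal (v \<bullet> y - \<beta> + q (y - x)) \<le> G y"
        unfolding G_def using add_right_mono[OF minorant[of y], of "ereal (q (y - x))"] by simp
      with y have "v \<bullet> y - \<beta> + q (y - x) \<le> R + q (x0 - x)"
        by (metis ereal_less_eq(3) order_trans)
      then have "q (y - x) \<le> - (v \<bullet> (y - x)) + (R + q (x0 - x) + \<beta> - v \<bullet> x)"
        by (simp add: inner_diff_right)
      moreover have "- (v \<bullet> (y - x)) \<le> norm v * norm (y - x)"
        using Cauchy_Schwarz_ineq2[of v "y - x"] by linarith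
      ultimately have "(norm (y - x))\<^sup>2 \<le> 2 * (norm v * norm (y - x)) + C"
        using abs_ge_self[of "R + q (x0 - x) + \<beta> - v \<bullet> x"]
        unfolding q_def[of "y - x"] C_def by argo
      then have "(norm (y - x))\<^sup>2 \<le> 2 * norm v * norm (y - x) + C" by simp
      then show ?thesis by (rule le_of_square_le_affine) (simp_all add: C_def)
    qed
    then have "{y. G y \<le> ereal (R + q (x0 - x))} \<subseteq> cball x (2 * norm v + C + 1)"
      by (auto simp: dist_norm norm_minus_commute)
    then show ?thesis using bounded_cball bounded_subset by blast
  qed
  have Gm: "G y \<noteq> -\<infinity>" for y using f(3)[of y] by (simp add: G_def)
  obtain p where p: "\<And>y. G p \<le> G y"
    using attains_minimum[OF G Gm G0 bdd] by blast
  have "G p < \<infinity>" using p[of x0] G0 by (cases "G p") auto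
  then obtain a where a: "f p = ereal a"
    using f(3)[of p] unfolding G_def by (cases "f p") auto
  have "(p, x - p) \<in> subdifferential f"
  proof (rule subdifferentialI[where f = f, OF a f(3)])
    fix y b assume b: "f y = ereal b"
    \<comment> \<open>Compare \<open>p\<close> with the points \<open>p + t (y - p)\<close>, divide by \<open>t\<close>, and let \<open>t\<close> tend to 0.\<close>
    have ineq: "0 \<le> b - a - (x - p) \<bullet> (y - p) + t * q (y - p)" if t: "0 < t" "t \<le> 1" for t
    proof -
      let ?z = "p + t *\<^sub>R (y - p)"
      have "f ?z \<le> ereal (a + t * (b - a))"
        using econvexD[OF f(2), of p a y b t] a b t by simp
      then have "G ?z \<le> ereal (a + t * (b - a)) + ereal (q (?z - x))"
        unfolding G_def by (rule add_right_mono)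
      with p[of ?z] have "G p \<le> ereal (a + t * (b - a)) + ereal (q (?z - x))"
        by (rule order_trans)
      then have "a + q (p - x) \<le> a + t * (b - a) + q (?z - x)"
        by (simp add: G_def a)
      moreover have "q (?z - x) = q (p - x) - t * ((x - p) \<bullet> (y - p)) + t * (t * q (y - p))"
        by (simp add: q_def power2_norm_eq_inner inner_diff inner_add inner_commute)
          (simp add: field_simps)
      ultimately have "0 \<le> t * (b - a - (x - p) \<bullet> (y - p) + t * q (y - p))"
        by (simp add: algebra_simps)
      then show ?thesis using t(1) by (simp add: zero_le_mult_iff)
    qed
    have "((\<lambda>t. b - a - (x - p) \<bullet> (y - p) + t * q (y - p)) \<longlongrightarrow>
        b - a - (x - p) \<bullet> (y - p) + 0 * q (y - p)) (at_right 0)"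
      by (intro tendsto_intros)
    moreover have "\<forall>\<^sub>F t in at_right 0. 0 \<le> b - a - (x - p) \<bullet> (y - p) + t * q (y - p)"
      unfolding eventually_at_right_field by (rule exI[of _ 1]) (auto intro: ineq)
    ultimately have "0 \<le> b - a - (x - p) \<bullet> (y - p) + 0 * q (y - p)"
      by (rule tendsto_lowerbound) simp
    then show "a + (x - p) \<bullet> (y - p) \<le> b" by simp
  qed
  then show thesis by (rule that)
qed

section \<open>Subgradients of essentially smooth functions\<close>

text \<open>The function \<open>f - \<langle>u, \<cdot>\<rangle>\<close> has a local minimum at \<open>p\<close>, so its derivative vanishes there.\<close>

lemma subgradient_is_gradient:
  assumes nm: "\<And>y. f y \<noteq> -\<infinity>" and p: "p \<in> interior (edom f)"
    and diff: "(\<lambda>y. real_of_ereal (f y)) differentiable (at p)"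
    and u: "(p, u) \<in> subdifferential f"
  shows "GDERIV (\<lambda>y. real_of_ereal (f y)) p :> u"
proof -
  let ?r = "\<lambda>y. real_of_ereal (f y)"
  obtain f' where f': "(?r has_derivative f') (at p)" using diff by (auto simp: differentiable_def)
  have "((\<lambda>y. ?r y - u \<bullet> y) has_derivative (\<lambda>h. f' h - u \<bullet> h)) (at p)"
    by (intro derivative_intros f')
  moreover have "\<forall>y\<in>interior (edom f). ?r p - u \<bullet> p \<le> ?r y - u \<bullet> y"
  proof
    fix y assume "y \<in> interior (edom f)"
    then have "f y < \<infinity>" using interior_subset by (auto simp: edom_def)
    moreover obtain a where "f p = ereal a" "ereal (a + u \<bullet> (y - p)) \<le> f y"
      using subdifferentialE[OF u nm] by blast
    ultimately show "?r p - u \<bullet> p \<le> ?r y - u \<bullet> y"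
      using nm[of y] by (cases "f y") (auto simp: inner_diff_right)
  qed
  ultimately have "(\<lambda>h. f' h - u \<bullet> h) = (\<lambda>h. 0)"
    using differential_zero_maxmin[OF p open_interior] by blast
  then have "f' = (\<lambda>h. h \<bullet> u)" by (auto simp: fun_eq_iff inner_commute dest: spec)
  then show ?thesis using f' unfolding gderiv_def by simp
qed

lemma subgradient_unique:
  assumes "\<And>y. f y \<noteq> -\<infinity>" "p \<in> interior (edom f)"
    and "(\<lambda>y. real_of_ereal (f y)) differentiable (at p)"
    and "(p, u) \<in> subdifferential f" "(p, v) \<in> subdifferential f"
  shows "u = v"
proof -
  have "(\<lambda>h. h \<bullet> u) = (\<lambda>h. h \<bullet> v)"
    using subgradient_is_gradient[OF assms(1-4)] subgradient_is_gradient[OF assms(1-3,5)]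
    unfolding gderiv_def by (rule has_derivative_unique)
  then show ?thesis by (metis inner_commute vector_eq_ldot)
qed

lemma bounded_above_near_interior_point:
  fixes f :: "'a::euclidean_space \<Rightarrow> ereal"
  assumes nm: "\<And>y. f y \<noteq> -\<infinity>" and a: "a \<in> interior (edom f)"
    and diff: "(\<lambda>y. real_of_ereal (f y)) differentiable (at a)"
  obtains \<epsilon> M where "0 < \<epsilon>" "\<And>y. y \<in> cball a \<epsilon> \<Longrightarrow> f y \<le> ereal M"
proof -
  let ?r = "\<lambda>y. real_of_ereal (f y)"
  have "isCont ?r a" using diff differentiable_imp_continuous_within by blast
  then have "(?r \<longlongrightarrow> ?r a) (nhds a)" 
    using tendsto_at_iff_tendsto_nhds[of ?r a] by (simp add: isCont_def)
  then have "\<forall>\<^sub>F y in nhds a. ?r y < ?r a + 1" by (rule order_tendstoD(2)) simp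
  moreover have "\<forall>\<^sub>F y in nhds a. y \<in> interior (edom f)"
    using a by (intro eventually_nhds_in_open) auto
  ultimately have "\<forall>\<^sub>F y in nhds a. f y \<le> ereal (?r a + 1)"
  proof eventually_elim
    case (elim y)
    then have "f y < \<infinity>" using interior_subset by (auto simp: edom_def)
    then show ?case using elim(1) nm[of y] by (cases "f y") auto
  qed
  then obtain d where d: "0 < d" "\<And>y. dist y a < d \<Longrightarrow> f y \<le> ereal (?r a + 1)"
    unfolding eventually_nhds_metric by blast
  then show thesis by (intro that[of "d / 2" "?r a + 1"]) (auto simp: dist_commute)
qed

text \<open>Let \<open>p\<close> be a point of the domain with a subgradient \<open>u\<close>, and approach it along the segment from a
  point \<open>a\<close> around which \<open>f\<close> is bounded by \<open>M\<close>. The gradients met on the way stay bounded: their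
  component along \<open>a - p\<close> is at least that of \<open>u\<close> by convexity, and testing the subgradient inequality
  on the ball around \<open>a\<close> then bounds their norm. Essential smoothness excludes this at a boundary
  point.\<close>

lemma subgradient_norm_bound_on_segment:
  fixes f :: "'a::real_inner \<Rightarrow> ereal"
  assumes nm: "\<And>y. f y \<noteq> -\<infinity>" and fp: "f p = ereal b" and u: "(p, u) \<in> subdifferential f"
    and \<epsilon>: "0 < \<epsilon>" and M: "\<And>y. y \<in> cball a \<epsilon> \<Longrightarrow> f y \<le> ereal M"
    and t: "0 < t" "t \<le> 1" and D: "(p + t *\<^sub>R (a - p), D) \<in> subdifferential f"
  shows "\<epsilon> * norm D \<le> M - b - u \<bullet> (a - p)"
proof -
  let ?x = "p + t *\<^sub>R (a - p)"
  obtain r where r: "f ?x = ereal r" "\<And>y. ereal (r + D \<bullet> (y - ?x)) \<le> f y"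
    using subdifferentialE[OF D nm] by blast
  have "ereal (b + u \<bullet> (y - p)) \<le> f y" for y
    using subdifferentialE[OF u nm] fp by (metis ereal.inject)
  from this[of ?x] have 1: "b + t * (u \<bullet> (a - p)) \<le> r" by (simp add: r(1))
  have "r - t * (D \<bullet> (a - p)) \<le> b" using r(2)[of p] by (simp add: fp)
  with 1 have "t * (u \<bullet> (a - p)) \<le> t * (D \<bullet> (a - p))" by linarith
  then have 2: "u \<bullet> (a - p) \<le> D \<bullet> (a - p)" using t(1) by simp
  \<comment> \<open>The point of the ball around \<open>a\<close> that is farthest in the direction \<open>D\<close>.\<close>
  let ?y = "a + \<epsilon> *\<^sub>R sgn D"
  have "?y \<in> cball a \<epsilon>" using \<epsilon> by (simp add: dist_norm norm_sgn)
  then have "r + D \<bullet> (?y - ?x) \<le> M"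
    using order_trans[OF r(2) M] by (metis ereal_less_eq(3))
  moreover have "D \<bullet> (?y - ?x) = (1 - t) * (D \<bullet> (a - p)) + \<epsilon> * (D \<bullet> sgn D)"
    by (simp add: inner_diff inner_add algebra_simps)
  moreover have "D \<bullet> sgn D = norm D"
    by (cases "D = 0") (simp_all add: sgn_div_norm power2_norm_eq_inner[symmetric] power2_eq_square)
  ultimately have "r + (1 - t) * (D \<bullet> (a - p)) + \<epsilon> * norm D \<le> M" by simp
  moreover have "(1 - t) * (u \<bullet> (a - p)) \<le> (1 - t) * (D \<bullet> (a - p))"
    using 2 t(2) by (intro mult_left_mono) auto
  ultimately show ?thesis using 1 by (simp add: algebra_simps)
qed

lemma subgradient_point_interior:
  fixes f :: "'a::euclidean_space \<Rightarrow> ereal"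
  assumes f: "essentially_smooth f"
    and int: "\<And>a. a \<in> interior (edom f) \<Longrightarrow> \<exists>D. (a, D) \<in> subdifferential f"
    and u: "(p, u) \<in> subdifferential f"
  shows "p \<in> interior (edom f)"
proof (rule ccontr)
  assume p: "p \<notin> interior (edom f)"
  have nm: "f y \<noteq> -\<infinity>" for y using f by (simp add: essentially_smooth_def proper_def)
  have diff: "(\<lambda>y. real_of_ereal (f y)) differentiable (at x)" if "x \<in> interior (edom f)" for x
    using f that by (simp add: essentially_smooth_def)
  obtain b where b: "f p = ereal b" using subdifferentialE[OF u nm] by blast
  then have pd: "p \<in> edom f" by (simp add: edom_def)
  then have front: "p \<in> frontier (edom f)" using p closure_subset by (auto simp: frontier_def)
  obtain a where a: "a \<in> interior (edom f)" using f by (auto simp: essentially_smooth_def)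
  obtain \<epsilon> M where \<epsilon>: "0 < \<epsilon>" and M: "\<And>y. y \<in> cball a \<epsilon> \<Longrightarrow> f y \<le> ereal M"
    using bounded_above_near_interior_point[OF nm a diff[OF a]] by blast
  have cvx: "convex (edom f)"
    unfolding convex_alt
  proof (intro ballI allI impI)
    fix x y t assume x: "x \<in> edom f" and y: "y \<in> edom f" and t: "0 \<le> t \<and> t \<le> (1::real)"
    obtain r s where "f x = ereal r" "f y = ereal s"
      using x y nm[of x] nm[of y] unfolding edom_def by (cases "f x"; cases "f y") auto
    then have "f (x + t *\<^sub>R (y - x)) \<le> ereal (r + t * (s - r))"
      using f t by (intro econvexD) (auto simp: essentially_smooth_def)
    also have "\<dots> < \<infinity>" by simp
    finally show "(1 - t) *\<^sub>R x + t *\<^sub>R y \<in> edom f"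
      by (simp add: edom_def algebra_simps)
  qed
  define t :: "nat \<Rightarrow> real" where "t k = inverse (real (Suc k))" for k
  have t: "0 < t k" "t k \<le> 1" for k by (auto simp: t_def inverse_le_1_iff)
  define X where "X k = p + t k *\<^sub>R (a - p)" for k
  have X: "X k \<in> interior (edom f)" for k
    using mem_interior_convex_shrink[OF cvx a pd t] by (simp add: X_def algebra_simps)
  then have "\<forall>k. \<exists>D. (X k, D) \<in> subdifferential f" using int by blast
  then obtain D where D: "\<And>k. (X k, D k) \<in> subdifferential f" by metis
  have "X \<longlonglongrightarrow> p + 0 *\<^sub>R (a - p)"
    unfolding X_def t_def by (intro tendsto_intros LIMSEQ_inverse_real_of_nat)
  then have "X \<longlonglongrightarrow> p" by simp
  moreover have "\<forall>k. X k \<in> interior (edom f) \<and> GDERIV (\<lambda>y. real_of_ereal (f y)) (X k) :> D k"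
    using X D subgradient_is_gradient[OF nm X diff[OF X]] by blast
  ultimately have lim: "filterlim (\<lambda>k. norm (D k)) at_top sequentially"
    using f front unfolding essentially_smooth_def by blast
  have "norm (D k) \<le> (M - b - u \<bullet> (a - p)) / \<epsilon>" for k
    using subgradient_norm_bound_on_segment[OF nm b u \<epsilon> M t D[unfolded X_def]] \<epsilon>
    by (simp add: field_simps)
  moreover have "\<forall>\<^sub>F k in sequentially. (M - b - u \<bullet> (a - p)) / \<epsilon> < norm (D k)"
    using lim unfolding filterlim_at_top_dense by blast
  ultimately show False
    by (metis (no_types, lifting) eventually_happens' not_le sequentially_bot)
qed

section \<open>The conjugate of a pair of functions\<close>

lemma cost_vector: "cost (vector [x, y, z]) = x \<bullet> (y + z) + y \<bullet> z"
  by (simp add: cost_def inner_add)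

text \<open>The two rules below cover only finite values of \<open>g\<close> and \<open>h\<close>; where one of them is \<open>\<infinity>\<close>, the term of the
  supremum is \<open>-\<infinity>\<close>.\<close>

lemma c_conjugate_upper:
  assumes "g y = ereal b" "h z = ereal c"
  shows "ereal (x \<bullet> (y + z) + y \<bullet> z - b - c) \<le> c_conjugate g h x"
proof -
  have "ereal (cost (vector [x, y, z])) - g y - h z \<le> c_conjugate g h x"
    unfolding c_conjugate_def by (rule SUP_upper2[of "(y, z)"]) auto
  then show ?thesis by (simp add: assms cost_vector)
qed

lemma c_conjugate_least:
  assumes g: "\<And>y. g y \<noteq> -\<infinity>" and h: "\<And>z. h z \<noteq> -\<infinity>"
    and le: "\<And>y z b c. g y = ereal b \<Longrightarrow> h z = ereal c \<Longrightarrow> ereal (x \<bullet> (y + z) + y \<bullet> z - b - c) \<le> m"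
  shows "c_conjugate g h x \<le> m"
  unfolding c_conjugate_def
proof (rule SUP_least, clarify)
  fix y z
  show "ereal (cost (vector [x, y, z])) - g y - h z \<le> m"
    using le[of y _ z] g[of y] h[of z] by (cases "g y"; cases "h z") (auto simp: cost_vector)
qed

lemma open_superlevels_c_conjugate:
  assumes g: "\<And>y. g y \<noteq> -\<infinity>" and h: "\<And>z. h z \<noteq> -\<infinity>"
  shows "open_superlevels (c_conjugate g h)"
  unfolding open_superlevels_def
proof
  fix r :: real
  let ?T = "\<lambda>w x. ereal (cost (vector [x, fst w, snd w])) - g (fst w) - h (snd w)"
  have "open {x. ereal r < ?T w x}" for w
    using g[of "fst w"] h[of "snd w"]
    by (cases "g (fst w)"; cases "h (snd w)")
      (auto simp: cost_vector intro!: open_Collect_less continuous_intros)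
  moreover have "{x. ereal r < c_conjugate g h x} = (\<Union>w. {x. ereal r < ?T w x})"
    by (simp add: set_eq_iff c_conjugate_def less_SUP_iff case_prod_unfold)
  ultimately show "open {x. ereal r < c_conjugate g h x}" by (simp add: open_UN)
qed

text \<open>Boundedness of \<open>f\<close> on a ball around \<open>p\<close> makes \<open>g y + h z - \<langle>y, z\<rangle> - \<langle>p, y + z\<rangle>\<close> grow at least
  linearly in \<open>y + z\<close>. When \<open>y + z\<close> is bounded, \<open>- \<langle>y, z\<rangle>\<close> grows quadratically in \<open>y\<close> and
  dominates the affine minorants of \<open>g\<close> and \<open>h\<close>. So the supremum is a maximum.\<close>

lemma c_conjugate_attained:
  fixes g h :: "'a::euclidean_space \<Rightarrow> ereal"
  defines "f \<equiv> c_conjugate g h"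
  assumes g: "\<And>y. g y \<noteq> -\<infinity>" "open_superlevels g" "g y0 = ereal b0"
    and h: "\<And>z. h z \<noteq> -\<infinity>" "open_superlevels h" "h z0 = ereal c0"
    and \<epsilon>: "0 < \<epsilon>" and M: "\<And>x. x \<in> cball p \<epsilon> \<Longrightarrow> f x \<le> ereal M"
  obtains y z b c where "g y = ereal b" "h z = ereal c"
    "f p = ereal (p \<bullet> (y + z) + y \<bullet> z - b - c)"
proof -
  have bound: "x \<bullet> (y + z) + y \<bullet> z - b - c \<le> M"
    if "x \<in> cball p \<epsilon>" "g y = ereal b" "h z = ereal c" for x y z b c
    using order_trans[OF c_conjugate_upper[of g y b h z c x] M[of x, unfolded f_def]] that by simp
  have bound_p: "p \<bullet> (y + z) + y \<bullet> z - b - c \<le> M" if "g y = ereal b" "h z = ereal c" for y z b c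
    using bound[of p y b z c] that \<epsilon> by simp
  define G where "G w = (g (fst w) + h (snd w)) + ereal (- (fst w \<bullet> snd w) - p \<bullet> (fst w + snd w))" for w
  have gh: "g y + h z \<noteq> -\<infinity>" for y z using g(1)[of y] h(1)[of z] by simp
  have "open_superlevels (\<lambda>w::'a \<times> 'a. g (fst w))" "open_superlevels (\<lambda>w::'a \<times> 'a. h (snd w))"
    by (rule open_superlevels_comp[OF g(2)] open_superlevels_comp[OF h(2)], intro continuous_intros)+
  then have "open_superlevels (\<lambda>w::'a \<times> 'a. g (fst w) + h (snd w))"
    by (rule open_superlevels_add[OF _ g(1) _ h(1)])
  moreover have "open_superlevels (\<lambda>w::'a \<times> 'a. ereal (- (fst w \<bullet> snd w) - p \<bullet> (fst w + snd w)))"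
    by (intro open_superlevels_continuous continuous_intros)
  ultimately have G: "open_superlevels G"
    unfolding G_def by (rule open_superlevels_add[OF _ gh]) simp
  have Gm: "G w \<noteq> -\<infinity>" for w using gh[of "fst w" "snd w"] by (simp add: G_def)
  define R where "R = b0 + c0 - y0 \<bullet> z0 - p \<bullet> (y0 + z0)"
  have G0: "G (y0, z0) = ereal R" by (simp add: G_def R_def g(3) h(3))
  have Gfin: "\<exists>b c. g y = ereal b \<and> h z = ereal c \<and> b + c - y \<bullet> z - p \<bullet> (y + z) \<le> S"
    if "G (y, z) \<le> ereal S" for y z S
    using that g(1)[of y] h(1)[of z] unfolding G_def by (cases "g y"; cases "h z") auto
  define W where "W = (R + M) / \<epsilon>"
  define K where "K = norm z0 + norm y0 + \<bar>W\<bar>"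
  define C where "C = \<bar>R + 2 * M + b0 + c0 - p \<bullet> (y0 + z0)\<bar> + norm y0 * \<bar>W\<bar>"
  have sub: "norm y \<le> K + C + 1 \<and> norm (y + z) \<le> W" if yz: "G (y, z) \<le> ereal R" for y z
  proof -
    obtain b c where b: "g y = ereal b" and c: "h z = ereal c"
      and le: "b + c - y \<bullet> z - p \<bullet> (y + z) \<le> R"
      using Gfin[OF yz] by blast
    let ?s = "y + z"
    \<comment> \<open>Moving from \<open>p\<close> in the direction of \<open>y + z\<close> increases \<open>\<langle>p, y + z\<rangle>\<close> the most.\<close>
    have "p + \<epsilon> *\<^sub>R sgn ?s \<in> cball p \<epsilon>" using \<epsilon> by (simp add: dist_norm norm_sgn)
    from bound[OF this b c] have "p \<bullet> ?s + \<epsilon> * (sgn ?s \<bullet> ?s) + y \<bullet> z - b - c \<le> M"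
      by (simp add: inner_add_left)
    moreover have "sgn ?s \<bullet> ?s = norm ?s"
      by (cases "?s = 0") (simp_all add: sgn_div_norm power2_norm_eq_inner[symmetric] power2_eq_square)
    ultimately have "p \<bullet> ?s + \<epsilon> * norm ?s + y \<bullet> z - b - c \<le> M" by (simp only:)
    then have "\<epsilon> * norm ?s \<le> R + M" using le by linarith
    then have s: "norm ?s \<le> W" using \<epsilon> by (simp add: W_def field_simps)
    \<comment> \<open>The affine minorants of \<open>g\<close> and \<open>h\<close> come from freezing the other variable at \<open>z0\<close> or \<open>y0\<close>.\<close>
    have gb: "p \<bullet> (y + z0) + y \<bullet> z0 - b - c0 \<le> M" using bound_p[OF b h(3)] .
    have hc: "p \<bullet> (y0 + z) + y0 \<bullet> z - b0 - c \<le> M" using bound_p[OF g(3) c] .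
    have "(norm y)\<^sup>2 = - (y \<bullet> z) + y \<bullet> ?s"
      by (simp add: power2_norm_eq_inner inner_add_right)
    also have "\<dots> \<le> (R + 2 * M + b0 + c0 - p \<bullet> (y0 + z0)) - y \<bullet> z0 + y0 \<bullet> y - y0 \<bullet> ?s + y \<bullet> ?s"
      using gb hc le by (simp add: inner_add inner_commute)
    also have "\<dots> \<le> \<bar>R + 2 * M + b0 + c0 - p \<bullet> (y0 + z0)\<bar> + norm z0 * norm y + norm y0 * norm y
        + norm y0 * \<bar>W\<bar> + \<bar>W\<bar> * norm y"
    proof -
      have "\<bar>y \<bullet> z0\<bar> \<le> norm z0 * norm y" "\<bar>y0 \<bullet> y\<bar> \<le> norm y0 * norm y"
        using Cauchy_Schwarz_ineq2[of y z0] Cauchy_Schwarz_ineq2[of y0 y] by (simp_all add: mult.commute)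
      moreover have "\<bar>y0 \<bullet> ?s\<bar> \<le> norm y0 * \<bar>W\<bar>"
        using Cauchy_Schwarz_ineq2[of y0 ?s] mult_left_mono[of "norm ?s" "\<bar>W\<bar>" "norm y0"] s by force
      moreover have "\<bar>y \<bullet> ?s\<bar> \<le> \<bar>W\<bar> * norm y"
        using Cauchy_Schwarz_ineq2[of y ?s] mult_left_mono[of "norm ?s" "\<bar>W\<bar>" "norm y"] s
        by (force simp: mult.commute)
      ultimately show ?thesis by linarith
    qed
    also have "\<dots> \<le> K * norm y + C" by (simp add: K_def C_def algebra_simps)
    finally show ?thesis
      using le_of_square_le_affine[of "norm y" K C] s by (simp add: K_def C_def)
  qed
  have bdd: "bounded {w. G w \<le> ereal R}"
  proof (rule boundedI)
    fix w assume "w \<in> {w. G w \<le> ereal R}"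
    then have w: "norm (fst w) \<le> K + C + 1" "norm (fst w + snd w) \<le> W"
      using sub[of "fst w" "snd w"] by auto
    have "norm (snd w) \<le> norm (fst w + snd w) + norm (fst w)"
      using norm_triangle_ineq4[of "fst w + snd w" "fst w"] by simp
    moreover have "norm w \<le> norm (fst w) + norm (snd w)"
      using norm_Pair_le[of "fst w" "snd w"] by simp
    ultimately show "norm w \<le> (K + C + 1) + (W + (K + C + 1))" using w by linarith
  qed
  obtain w where w: "\<And>w'. G w \<le> G w'" using attains_minimum[OF G Gm G0 bdd] by blast
  obtain y z where yz: "w = (y, z)" by force
  obtain b c where b: "g y = ereal b" and c: "h z = ereal c"
    using Gfin[of y z R] w[of "(y0, z0)"] unfolding yz G0 by blast
  have "f p = ereal (p \<bullet> (y + z) + y \<bullet> z - b - c)"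
  proof (rule antisym)
    show "f p \<le> ereal (p \<bullet> (y + z) + y \<bullet> z - b - c)"
      unfolding f_def
    proof (rule c_conjugate_least[OF g(1) h(1)])
      fix y' z' b' c' assume "g y' = ereal b'" "h z' = ereal c'"
      then show "ereal (p \<bullet> (y' + z') + y' \<bullet> z' - b' - c') \<le> ereal (p \<bullet> (y + z) + y \<bullet> z - b - c)"
        using w[of "(y', z')"] b c by (simp add: yz G_def)
    qed
    show "ereal (p \<bullet> (y + z) + y \<bullet> z - b - c) \<le> f p"
      unfolding f_def by (rule c_conjugate_upper[of g y b h z c p, OF b c])
  qed
  with b c show thesis by (rule that)
qed

section \<open>The splitting set generated by an essentially smooth conjugate\<close>

theorem theorem4p6:
  fixes f g h :: "real^'n \<Rightarrow> ereal"
    and F :: "3 \<Rightarrow> real^'n \<Rightarrow> ereal"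
    and \<Gamma> :: "((real^'n)^3) set"
  assumes "proper g" and "lsc g" and "econvex g"
    and "proper h" and "lsc h" and "econvex h"
    and "f = c_conjugate g h"
    and "essentially_smooth f"
    and "F 1 = f" and "F 2 = g" and "F 3 = h"
    and "\<Gamma> = c_splitting_set F"
  shows "(\<exists>i\<^sub>0. maximally_monotone (A_op \<Gamma> i\<^sub>0)) \<and>
         (\<exists>i\<^sub>0. A_op \<Gamma> i\<^sub>0 = subdifferential (F i\<^sub>0)) \<and>
         (\<forall>i. A_op \<Gamma> i = subdifferential (F i)) \<and>
         (\<forall>x. Prox (F 1) x + Prox (F 2) x + Prox (F 3) x = x) \<and>
         (\<forall>x. moreau_envelope (fenchel_conjugate (F 1)) x
              + moreau_envelope (fenchel_conjugate (F 2)) x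
              + moreau_envelope (fenchel_conjugate (F 3)) x = ereal (q x)) \<and>
         maximally_c_monotone \<Gamma>"
proof -
  have gm: "g y \<noteq> -\<infinity>" and hm: "h y \<noteq> -\<infinity>" for y
    using assms(1,4) by (auto simp: proper_def)
  have fp: "proper f" and fc: "econvex f" using assms(8) by (auto simp: essentially_smooth_def)
  then have fm: "f y \<noteq> -\<infinity>" for y by (auto simp: proper_def)
  have finite_value: "\<exists>x r. \<phi> x = ereal r" if "proper \<phi>" for \<phi> :: "real^'n \<Rightarrow> ereal"
  proof -
    obtain x where "\<phi> x < \<infinity>" "\<phi> x \<noteq> -\<infinity>" using \<open>proper \<phi>\<close> by (auto simp: proper_def edom_def)
    then show ?thesis by (cases "\<phi> x") auto
  qed
  obtain x0 R where x0: "f x0 = ereal R" using finite_value[OF fp] by blast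
  obtain y0 b0 where y0: "g y0 = ereal b0" using finite_value[OF assms(1)] by blast
  obtain z0 c0 where z0: "h z0 = ereal c0" using finite_value[OF assms(4)] by blast
  have diff: "(\<lambda>y. real_of_ereal (f y)) differentiable (at a)" if "a \<in> interior (edom f)" for a
    using assms(8) that by (simp add: essentially_smooth_def)
  have Fm: "F i t \<noteq> -\<infinity>" for i t
  proof -
    have "\<forall>i. F i t \<noteq> -\<infinity>" unfolding forall_3 assms(9-11) using fm gm hm by blast
    then show ?thesis by blast
  qed
  have dom: "dominates_cost F"
    unfolding dominates_cost_def
  proof (intro conjI allI Fm)
    fix x :: "(real^'n)^3"
    show "ereal (cost x) \<le> (\<Sum>i\<in>UNIV. F i (x$i))"
    proof (cases "g (x$2) = \<infinity> \<or> h (x$3) = \<infinity>")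
      case True
      then have "(\<Sum>i\<in>UNIV. F i (x$i)) = \<infinity>"
        using fm gm hm by (auto simp: sum_3 assms(9-11))
      then show ?thesis by simp
    next
      case False
      then obtain b c where "g (x$2) = ereal b" "h (x$3) = ereal c"
        using gm[of "x$2"] hm[of "x$3"] by (cases "g (x$2)"; cases "h (x$3)") auto
      moreover from c_conjugate_upper[of g "x$2" b h "x$3" c "x$1", OF this]
      have "ereal (cost x - b - c) \<le> f (x$1)"
        by (simp add: assms(7) cost_def inner_add algebra_simps)
      ultimately show ?thesis
        using fm[of "x$1"] by (cases "f (x$1)") (simp_all add: sum_3 assms(9-11))
    qed
  qed
  have attained: "\<exists>x\<in>\<Gamma>. x$1 = a \<and> (a, x$2 + x$3) \<in> subdifferential f"
    if a: "a \<in> interior (edom f)" for a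
  proof -
    obtain \<epsilon> M where "0 < \<epsilon>" "\<And>y. y \<in> cball a \<epsilon> \<Longrightarrow> f y \<le> ereal M"
      using bounded_above_near_interior_point[OF fm a diff[OF a]] by blast
    then obtain y z b c where yz: "g y = ereal b" "h z = ereal c"
      "f a = ereal (a \<bullet> (y + z) + y \<bullet> z - b - c)"
      using c_conjugate_attained[OF gm lsc_imp_open_superlevels[OF assms(2)] y0
          hm lsc_imp_open_superlevels[OF assms(5)] z0] unfolding assms(7) by metis
    let ?x = "vector [a, y, z] :: (real^'n)^3"
    have x: "?x \<in> c_splitting_set F"
      by (simp add: c_splitting_set_def sum_3 assms(9-11) yz cost_vector)
    have "(?x$1, \<Sum>k\<in>UNIV - {1}. ?x$k) \<in> subdifferential (F 1)"
      by (rule splitting_point_subgradient[OF dom x])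
    then have "(a, y + z) \<in> subdifferential f"
      unfolding sum_others by (simp add: sum_3 assms(9))
    then show ?thesis using x unfolding assms(12) by (intro bexI[of _ ?x]) auto
  qed
  have fill: "\<exists>x\<in>c_splitting_set F. (\<Sum>i\<in>UNIV. x$i) = s" for s
  proof -
    have "ereal ((y0 + z0) \<bullet> x - (b0 + c0 - y0 \<bullet> z0)) \<le> f x" for x
      using c_conjugate_upper[of g y0 b0 h z0 c0 x, OF y0 z0] by (simp add: assms(7) inner_commute algebra_simps)
    then obtain p where p: "(p, s - p) \<in> subdifferential f"
      using proximal_point_exists[of f x0 R "y0 + z0" "b0 + c0 - y0 \<bullet> z0" s]
        open_superlevels_c_conjugate[of g h, OF gm hm] fc fm x0 unfolding assms(7) by blast
    have int: "p \<in> interior (edom f)"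
      using subgradient_point_interior[OF assms(8) _ p] attained by blast
    then obtain x where x: "x \<in> \<Gamma>" "x$1 = p" "(p, x$2 + x$3) \<in> subdifferential f"
      using attained by blast
    have "x$2 + x$3 = s - p"
      by (rule subgradient_unique[OF fm int diff[OF int] x(3) p])
    then show ?thesis using x(1,2) by (auto simp: sum_3 assms(12) algebra_simps intro!: bexI[of _ x])
  qed
  note result = splitting_set_if_sums_fill[OF dom fill]
  show ?thesis unfolding assms(12) using result by blast
qed

end
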